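(* Let $V\subset\mathbb{C}[x]$ be a finite-dimensional subspace with a basis $p_1,\dots,p_n$ of monic polynomials $p_j=x^{i_j}+c_{j1}x^{i_j-1}+\cdots$ of pairwise distinct degrees $i_1,\dots,i_n$, and let $V(g)=\langle x^{i_1},\dots,x^{i_n}\rangle$ be the associated graded space. Let $T$ be a nonzero linear differential operator of order $k$ with polynomial coefficients, written as $T=\sum_{i=-k}^{m}T^{(i)}$ with $T^{(i)}$ homogeneous of degree $i$ and $T^{(m)}\neq 0$. If $T(V)\subset V$, then $T^{(m)}(V(g))\subset V(g)$.
   Context: $\partial=d/dx$. Operators are finite-order linear differential operators $\sum_i P_i\partial^i$ with $P_i\in\mathbb{C}[x]$, acting on $\mathbb{C}[x]$. An operator $S$ is homogeneous of degree $d\in\mathbb{Z}$ if $S(x^i)\in\langle x^{i+d}\rangle$ for all integers $i\ge 0$ (with $\langle x^{j}\rangle=0$ for $j<0$). Every operator of order $k$ decomposes uniquely as a finite sum of homogeneous differential operators of degrees $\geq -k$. Every finite-dimensional subspace of $\mathbb{C}[x]$ has a basis as described. $\langle\cdot\rangle$ denotes complex linear span. *)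

theory Defs
  imports Complex_Main "HOL-Computational_Algebra.Polynomial"
begin

global_interpretation cpoly: vector_space "smult :: complex \<Rightarrow> complex poly \<Rightarrow> complex poly"
  by unfold_locales (simp_all add: smult_add_right smult_add_left)

text \<open>Differential operators are represented by their action on polynomials. In characteristic
  zero this action determines the coefficients, so an operator has at most one order; the zero
  operator has none.\<close>

definition diff_op_of :: "nat \<Rightarrow> (nat \<Rightarrow> complex poly) \<Rightarrow> complex poly \<Rightarrow> complex poly" where
  "diff_op_of k P f = (\<Sum>i\<le>k. P i * (pderiv ^^ i) f)"

definition is_diff_op :: "(complex poly \<Rightarrow> complex poly) \<Rightarrow> bool" where
  "is_diff_op T \<longleftrightarrow> (\<exists>k P. T = diff_op_of k P)"

definition has_diff_order :: "(complex poly \<Rightarrow> complex poly) \<Rightarrow> nat \<Rightarrow> bool" where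
  "has_diff_order T k \<longleftrightarrow> (\<exists>P. T = diff_op_of k P \<and> P k \<noteq> 0)"

text \<open>The span of \<open>x ^ j\<close>, which is the zero space for \<open>j < 0\<close>.\<close>

definition monom_line :: "int \<Rightarrow> complex poly set" where
  "monom_line j = cpoly.span (if j < 0 then {} else {monom 1 (nat j)})"

definition homogeneous_op :: "int \<Rightarrow> (complex poly \<Rightarrow> complex poly) \<Rightarrow> bool" where
  "homogeneous_op d S \<longleftrightarrow>
     is_diff_op S \<and> (\<forall>i::nat. S (monom 1 i) \<in> monom_line (int i + d))"

text \<open>The associated graded space, computed from a basis of pairwise distinct degrees.\<close>

definition assoc_graded :: "nat \<Rightarrow> (nat \<Rightarrow> complex poly) \<Rightarrow> complex poly set" where
  "assoc_graded n p = cpoly.span ((\<lambda>j. monom 1 (degree (p j))) ` {1..n})"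

end

theory Submission
  imports Defs
begin

text \<open>If \<open>T\<^bsup>(m)\<^esup>\<close> maps \<open>x ^ i\<close> to \<open>c x ^ (i + m)\<close> with \<open>c \<noteq> 0\<close>, where \<open>i = deg p\<^sub>j\<close>, then \<open>c\<close> is the leading
  coefficient of \<open>T p\<^sub>j\<close>, since the components of lower degree do not reach \<open>x ^ (i + m)\<close>. So
  \<open>V\<close> contains an element of degree \<open>i + m\<close>, and the degrees of nonzero elements of \<open>V\<close> are
  exactly the degrees of the basis.\<close>

lemma higher_pderiv_add: "(pderiv ^^ i) (f + g) = (pderiv ^^ i) f + (pderiv ^^ i) g"
  by (induction i) (simp_all add: pderiv_add)

lemma higher_pderiv_smult: "(pderiv ^^ i) (smult c f) = smult c ((pderiv ^^ i) f)"
  by (induction i) (simp_all add: pderiv_smult)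

lemma is_diff_op_add: "is_diff_op S \<Longrightarrow> S (f + g) = S f + S g"
  by (auto simp: is_diff_op_def diff_op_of_def higher_pderiv_add distrib_left sum.distrib)

lemma is_diff_op_smult: "is_diff_op S \<Longrightarrow> S (smult c f) = smult c (S f)"
  by (auto simp: is_diff_op_def diff_op_of_def higher_pderiv_smult cpoly.scale_sum_right)

lemma is_diff_op_zero: "is_diff_op S \<Longrightarrow> S 0 = 0"
  using is_diff_op_smult[of S 0 0] by simp

lemma is_diff_op_sum:
  assumes "is_diff_op S"
  shows "S (\<Sum>i\<in>A. f i) = (\<Sum>i\<in>A. S (f i))"
  by (induction A rule: infinite_finite_induct)
     (simp_all add: is_diff_op_zero[OF assms] is_diff_op_add[OF assms])

text \<open>Linearity: expand \<open>f\<close> in monomials. Homogeneity constrains only the values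
  on monomials, so questions about \<open>S f\<close> are reduced to those.\<close>

lemma coeff_diff_op:
  assumes "is_diff_op S"
  shows "coeff (S f) e = (\<Sum>i\<le>degree f. coeff f i * coeff (S (monom 1 i)) e)"
proof -
  have "S f = S (\<Sum>i\<le>degree f. smult (coeff f i) (monom 1 i))"
    by (simp add: smult_monom poly_as_sum_of_monoms)
  also have "\<dots> = (\<Sum>i\<le>degree f. smult (coeff f i) (S (monom 1 i)))"
    by (simp add: is_diff_op_sum[OF assms] is_diff_op_smult[OF assms])
  finally show ?thesis
    by (simp add: coeff_sum)
qed

text \<open>Comparing in the integers covers a negative \<open>int i + d\<close> too: no
  \<open>e\<close> equals it, and the line is then zero.\<close>

lemma homogeneous_op_coeff_monom:
  assumes "homogeneous_op d S" and "int e \<noteq> int i + d"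
  shows "coeff (S (monom 1 i)) e = 0"
proof -
  have "S (monom 1 i) \<in> monom_line (int i + d)"
    using assms(1) by (simp add: homogeneous_op_def)
  with assms(2) show ?thesis
    by (auto simp: monom_line_def cpoly.span_singleton split: if_splits)
qed

text \<open>The terms of \<open>f\<close> below the leading one are sent to exponents below
  \<open>int (degree f) + d\<close>, so they cannot contribute at \<open>e\<close>. Allowing every
  larger \<open>e\<close> makes the lemma yield degree bounds as well as a top coefficient.\<close>

lemma homogeneous_op_coeff:
  assumes "homogeneous_op d S" and "int (degree f) + d \<le> int e"
  shows "coeff (S f) e = lead_coeff f * coeff (S (monom 1 (degree f))) e"
proof -
  have "coeff (S f) e = (\<Sum>i\<le>degree f. coeff f i * coeff (S (monom 1 i)) e)"
    using assms(1) by (intro coeff_diff_op) (simp add: homogeneous_op_def)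
  also have "\<dots> = (\<Sum>i\<in>{degree f}. coeff f i * coeff (S (monom 1 i)) e)"
  proof (rule sum.mono_neutral_right)
    show "\<forall>i\<in>{..degree f} - {degree f}. coeff f i * coeff (S (monom 1 i)) e = 0"
      using assms(2) by (auto intro!: homogeneous_op_coeff_monom[OF assms(1)])
  qed auto
  finally show ?thesis by simp
qed

text \<open>A nonzero value rules out the zero line, so \<open>int i + d\<close> is nonnegative and
  is a genuine exponent.\<close>

lemma homogeneous_op_monom_eq:
  assumes "homogeneous_op d S" and "S (monom 1 i) \<noteq> 0"
  obtains e c where "int e = int i + d" "c \<noteq> 0" "S (monom 1 i) = monom c e"
proof -
  have "S (monom 1 i) \<in> monom_line (int i + d)"
    using assms(1) by (simp add: homogeneous_op_def)
  with assms(2) have "int (nat (int i + d)) = int i + d"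
    and "\<exists>c. S (monom 1 i) = monom c (nat (int i + d))"
    by (auto simp: monom_line_def cpoly.span_singleton smult_monom split: if_splits)
  with assms(2) that show thesis by (metis monom_eq_0_iff)
qed

text \<open>In a linear combination of polynomials of distinct degrees, the nonzero term of highest
  degree has nothing to cancel against.\<close>

lemma degree_in_span:
  assumes "finite A" and inj: "inj_on degree A"
    and f: "f \<in> cpoly.span A" "f \<noteq> 0"
  shows "degree f \<in> degree ` A"
proof -
  obtain a where a: "f = (\<Sum>q\<in>A. smult (a q) q)"
    using f(1) by (auto simp: cpoly.span_finite[OF assms(1)])
  \<comment> \<open>Testing the product instead of \<open>a q\<close> also discards a zero
    polynomial in \<open>A\<close>, so each remaining term has a nonzero coefficient at
    \<open>degree q\<close>.\<close>
  define B where "B = {q\<in>A. smult (a q) q \<noteq> 0}"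
  have "finite B" using assms(1) by (simp add: B_def)
  have fB: "f = (\<Sum>q\<in>B. smult (a q) q)"
    unfolding a B_def using assms(1) by (intro sum.mono_neutral_right) auto
  with f(2) have "B \<noteq> {}" by auto
  have "finite (degree ` B)" "degree ` B \<noteq> {}"
    using \<open>finite B\<close> \<open>B \<noteq> {}\<close> by auto
  then obtain r where r: "r \<in> B" "degree r = Max (degree ` B)"
    by (metis (no_types, lifting) Max_in imageE)
  have le: "degree q \<le> degree r" if "q \<in> B" for q
    using r that \<open>finite B\<close> by simp
  have "coeff f (degree r) = (\<Sum>q\<in>{r}. coeff (smult (a q) q) (degree r))"
    unfolding fB coeff_sum
  proof (rule sum.mono_neutral_right[OF \<open>finite B\<close>])
    show "\<forall>q\<in>B - {r}. coeff (smult (a q) q) (degree r) = 0"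
    proof
      fix q assume q: "q \<in> B - {r}"
      then have "degree q \<noteq> degree r"
        using inj r(1) by (auto simp: B_def inj_on_def)
      with le[of q] q show "coeff (smult (a q) q) (degree r) = 0"
        by (simp add: coeff_eq_0)
    qed
  qed (use r in auto)
  then have "coeff f (degree r) \<noteq> 0"
    using r(1) by (auto simp: B_def)
  moreover have "degree f \<le> degree r"
    unfolding fB using \<open>finite B\<close> le by (intro degree_sum_le) auto
  ultimately have "degree f = degree r"
    by (metis le_antisym le_degree)
  with r(1) show ?thesis by (auto simp: B_def)
qed

theorem theorem4p1:
  fixes V :: "complex poly set" and n :: nat and p :: "nat \<Rightarrow> complex poly"
    and T :: "complex poly \<Rightarrow> complex poly" and k :: nat and m :: int
    and Tc :: "int \<Rightarrow> complex poly \<Rightarrow> complex poly"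
  assumes "cpoly.subspace V"
    and "cpoly.independent (p ` {1..n})" and "cpoly.span (p ` {1..n}) = V"
    and "\<forall>j\<in>{1..n}. lead_coeff (p j) = 1"
    and "inj_on (\<lambda>j. degree (p j)) {1..n}"
    and "T \<noteq> (\<lambda>f. 0)" and "has_diff_order T k"
    and "T = (\<lambda>f. \<Sum>i = - int k..m. Tc i f)"
    and "\<forall>i\<in>{- int k..m}. homogeneous_op i (Tc i)"
    and "Tc m \<noteq> (\<lambda>f. 0)"
    and "T ` V \<subseteq> V"
  shows "Tc m ` assoc_graded n p \<subseteq> assoc_graded n p"
proof -
  \<comment> \<open>Otherwise the sum defining \<open>T\<close> is empty and \<open>T\<close> is
    zero.\<close>
  have "- int k \<le> m"
    using assms(6,8) by (metis atLeastatMost_empty_iff sum.empty)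
  then have hom: "homogeneous_op m (Tc m)"
    using assms(9) by simp
  then have diff: "is_diff_op (Tc m)"
    by (simp add: homogeneous_op_def)
  have coeff_T: "coeff (T f) e = coeff (Tc m f) e" if "int (degree f) + m \<le> int e" for f e
  proof -
    have "coeff (T f) e = (\<Sum>i = - int k..m. coeff (Tc i f) e)"
      by (simp add: assms(8) coeff_sum)
    also have "\<dots> = (\<Sum>i\<in>{m}. coeff (Tc i f) e)"
    proof (rule sum.mono_neutral_right)
      show "\<forall>i\<in>{- int k..m} - {m}. coeff (Tc i f) e = 0"
      proof
        fix i assume i: "i \<in> {- int k..m} - {m}"
        then have h: "homogeneous_op i (Tc i)" using assms(9) by simp
        \<comment> \<open>Since \<open>i < m\<close>, the exponent \<open>e\<close> lies strictly
          above \<open>int (degree f) + i\<close>: only the leading monomial of \<open>f\<close>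
          could contribute at \<open>e\<close>, and its image misses \<open>e\<close>.\<close>
        show "coeff (Tc i f) e = 0"
          using i that homogeneous_op_coeff[OF h, of f e]
            homogeneous_op_coeff_monom[OF h, of e "degree f"] by simp
      qed
    qed (use \<open>- int k \<le> m\<close> in auto)
    finally show ?thesis by simp
  qed
  have gen: "Tc m (monom 1 (degree (p j))) \<in> assoc_graded n p" if j: "j \<in> {1..n}" for j
  proof (cases "Tc m (monom 1 (degree (p j))) = 0")
    case True
    then show ?thesis by (simp add: assoc_graded_def cpoly.span_zero)
  next
    case False
    then obtain e c where e: "int e = int (degree (p j)) + m" and "c \<noteq> 0"
      and mon: "Tc m (monom 1 (degree (p j))) = monom c e"
      using homogeneous_op_monom_eq[OF hom] by metis
    \<comment> \<open>As \<open>p j\<close> is monic, no extra factor appears. The case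
      \<open>e' = e\<close> gives a nonzero coefficient, and \<open>e' > e\<close> bounds the
      degree.\<close>
    have coeff_Tp: "coeff (T (p j)) e' = coeff (monom c e) e'" if "e \<le> e'" for e'
      using that e j assms(4) mon coeff_T[of "p j" e'] homogeneous_op_coeff[OF hom, of "p j" e']
      by simp
    have nz: "coeff (T (p j)) e \<noteq> 0"
      using coeff_Tp[of e] \<open>c \<noteq> 0\<close> by simp
    have "degree (T (p j)) \<le> e"
      using coeff_Tp by (intro degree_le) simp
    with nz have deg: "degree (T (p j)) = e"
      by (metis le_antisym le_degree)
    have "p j \<in> V"
      using j assms(3) by (metis cpoly.span_base imageI)
    then have "T (p j) \<in> cpoly.span (p ` {1..n})"
      unfolding assms(3) by (rule subsetD[OF assms(11) imageI])
    moreover have "inj_on degree (p ` {1..n})"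
      using assms(5) by (intro inj_on_imageI) (simp add: comp_def)
    ultimately have "degree (T (p j)) \<in> degree ` p ` {1..n}"
      using nz by (intro degree_in_span) auto
    \<comment> \<open>\<open>e\<close> is now the degree of some basis element, so
      \<open>monom 1 e\<close> is one of the spanning monomials.\<close>
    then have "monom 1 e \<in> assoc_graded n p"
      unfolding deg by (auto simp: assoc_graded_def intro!: cpoly.span_base)
    then have "smult c (monom 1 e) \<in> assoc_graded n p"
      unfolding assoc_graded_def by (rule cpoly.span_scale)
    then show ?thesis by (simp add: mon smult_monom)
  qed
  \<comment> \<open>Linearity of \<open>Tc m\<close> carries the claim from the spanning monomials
    to their span.\<close>
  have "Tc m f \<in> assoc_graded n p" if "f \<in> assoc_graded n p" for f
    using that unfolding assoc_graded_def[of n p]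
  proof (induction rule: cpoly.span_induct_alt)
    case base
    show ?case by (simp add: is_diff_op_zero[OF diff] cpoly.span_zero)
  next
    case (step c x y)
    then have "Tc m x \<in> cpoly.span ((\<lambda>j. monom 1 (degree (p j))) ` {1..n})"
      using gen by (auto simp: assoc_graded_def)
    with step show ?case
      by (simp add: is_diff_op_add[OF diff] is_diff_op_smult[OF diff]
          cpoly.span_add cpoly.span_scale)
  qed
  then show ?thesis by blast
qed

end
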